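(* Let $d\geq 1$ be an integer, let $r > 1$, and let $1\leq p,q \leq \infty$ be such that $\frac{1}{p}+\frac{1}{q}=\frac{\log_{2}(2^r+2)}{r}$. If $$\|f*g\|_{\ell^r(\mathbb{Z}^d)}\leq \|f\|_{\ell^p(\mathbb{Z}^d)}\,\|g\|_{\ell^q(\mathbb{Z}^d)}$$ holds for all $f,g:\mathbb{Z}^d\to \mathbb{R}$ supported in $\{0,1\}^d$, then both $p$ and $q$ belong to the interval $$\left[\frac{r+2^{r-1}}{1+2^{r-1}},\ \frac{1}{\frac{\log_2 (2^r+2)}{r}-\frac{1+2^{r-1}}{r+2^{r-1}}}\right].$$
   Context: A function $f:\mathbb{Z}^d\to\mathbb{R}$ is supported in $\{0,1\}^d$ if $f(x)=0$ for all $x\notin\{0,1\}^d$. Convolution: $(f*g)(x)=\sum_{y\in\mathbb{Z}^d} f(y)g(x-y)$. Norms: $\|f\|_{\ell^p(\mathbb{Z}^d)}=\big(\sum_{x\in\mathbb{Z}^d}|f(x)|^p\big)^{1/p}$ for $0<p<\infty$, and $\|f\|_{\ell^\infty(\mathbb{Z}^d)}=\sup_x|f(x)|$; the convention $1/\infty=0$ is used. *)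

theory Defs
  imports "HOL-Analysis.Analysis"
begin

text \<open>
  The lattice of rank d is the type \<^typ>\<open>int ^ 'd\<close> with d being the cardinality of the index
  type \<^typ>\<open>'d::finite\<close>; types are nonempty, so d is at least 1.
\<close>

definition cube :: "(int ^ 'd::finite) set" where
  "cube = {x. \<forall>i. x $ i \<in> {0, 1}}"

definition supported_in :: "('a \<Rightarrow> real) \<Rightarrow> 'a set \<Rightarrow> bool" where
  "supported_in f S \<longleftrightarrow> (\<forall>x. x \<notin> S \<longrightarrow> f x = 0)"

text \<open>
  The following sums and suprema are real-valued, so they carry the intended meaning only for
  summable (respectively bounded) arguments. They are used for finitely supported functions.
\<close>

definition convolution ::
  "(int ^ 'd::finite \<Rightarrow> real) \<Rightarrow> (int ^ 'd \<Rightarrow> real) \<Rightarrow> int ^ 'd \<Rightarrow> real" where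
  "convolution f g x = (\<Sum>\<^sub>\<infinity>y\<in>UNIV. f y * g (x - y))"

definition lp_norm :: "ereal \<Rightarrow> ('a \<Rightarrow> real) \<Rightarrow> real" where
  "lp_norm p f =
    (if p = \<infinity> then (SUP x. \<bar>f x\<bar>)
     else (\<Sum>\<^sub>\<infinity>x\<in>UNIV. \<bar>f x\<bar> powr real_of_ereal p) powr (1 / real_of_ereal p))"

end

theory Submission
  imports Defs
begin

text \<open>
  Fix a unit vector \<open>e\<close> of the lattice and test the inequality on \<open>f = \<delta>\<^sub>0 + a \<delta>\<^sub>e\<close> and
  \<open>g = \<delta>\<^sub>0 + b \<delta>\<^sub>e\<close>, whose convolution is \<open>\<delta>\<^sub>0 + (a + b) \<delta>\<^sub>e + a b \<delta>\<^sub>2\<^sub>e\<close>.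
  The condition on \<open>1/p + 1/q\<close> says exactly that equality holds at \<open>a = b = 1\<close>. With \<open>b = 1\<close> and
  \<open>p\<close> finite, the function
  \<open>h(a) = (1/r) ln (1 + (1 + a)\<^sup>r + a\<^sup>r) - (1/p) ln (1 + a\<^sup>p)\<close>
  therefore has a maximum at \<open>a = 1\<close>. Its derivative vanishes there, so the second derivative must
  satisfy \<open>h''(1) \<le> 0\<close>, and this is the lower bound
  \<open>p \<ge> (r + 2\<^bsup>r-1\<^esup>) / (1 + 2\<^bsup>r-1\<^esup>)\<close> (\<open>second_order_condition\<close>).
  For \<open>p = \<infinity>\<close> the lower bound is trivial. Exchanging the roles of \<open>f\<close> and \<open>g\<close> gives the same
  lower bound \<open>L\<close> for \<open>q\<close>. The upper bounds follow from the lower bounds, because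
  \<open>1/p + 1/q = C\<close> is prescribed and \<open>C > 1 > 1/L\<close>.
\<close>

section \<open>Two-point functions\<close>

text \<open>The function \<open>\<delta>\<^sub>0 + a \<delta>\<^sub>e\<close>, for \<open>e \<noteq> 0\<close>.\<close>

definition two_point :: "'a::zero \<Rightarrow> real \<Rightarrow> 'a \<Rightarrow> real" where
  "two_point e a x = (if x = 0 then 1 else if x = e then a else 0)"

lemma supported_in_two_point_axis: "supported_in (two_point (axis i 1) a) cube"
  by (auto simp: supported_in_def two_point_def cube_def axis_def)

lemma infsum_eq_sum_if_zero_outside:
  fixes f :: "'a \<Rightarrow> real"
  assumes "finite A" and "\<And>x. x \<notin> A \<Longrightarrow> f x = 0"
  shows "(\<Sum>\<^sub>\<infinity>x\<in>UNIV. f x) = sum f A"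
proof -
  have "(\<Sum>\<^sub>\<infinity>x\<in>UNIV. f x) = (\<Sum>\<^sub>\<infinity>x\<in>A. f x)"
    by (rule infsum_cong_neutral) (use assms in auto)
  thus ?thesis using assms(1) by simp
qed

lemma convolution_two_point:
  fixes e :: "int ^ 'd::finite"
  assumes "e \<noteq> 0"
  shows "convolution (two_point e a) (two_point e b) x =
    (if x = 0 then 1 else if x = e then a + b else if x = e + e then a * b else 0)"
proof -
  have not_torsion: "e + e \<noteq> 0"
    using assms by (auto simp: vec_eq_iff)
  have "convolution (two_point e a) (two_point e b) x =
      (\<Sum>y\<in>{0, e}. two_point e a y * two_point e b (x - y))"
    unfolding convolution_def
    by (rule infsum_eq_sum_if_zero_outside) (auto simp: two_point_def)
  also have "\<dots> = two_point e b x + a * two_point e b (x - e)"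
    using assms by (simp add: two_point_def)
  also have "\<dots> = (if x = 0 then 1 else if x = e then a + b else if x = e + e then a * b else 0)"
  proof -
    have "- e \<noteq> e" using not_torsion by (metis add.right_inverse)
    moreover have "x - e = e \<longleftrightarrow> x = e + e" by (simp add: diff_eq_eq)
    ultimately show ?thesis
      using assms not_torsion by (auto simp: two_point_def)
  qed
  finally show ?thesis .
qed

lemma lp_norm_convolution_two_point:
  fixes e :: "int ^ 'd::finite"
  assumes "e \<noteq> 0" and "a \<ge> 0" and "b \<ge> 0"
  shows "lp_norm (ereal r) (convolution (two_point e a) (two_point e b)) =
    (1 + (a + b) powr r + (a * b) powr r) powr (1 / r)"
proof -
  have not_torsion: "e + e \<noteq> 0"
    using assms by (auto simp: vec_eq_iff)
  have "(\<Sum>\<^sub>\<infinity>x\<in>UNIV. \<bar>convolution (two_point e a) (two_point e b) x\<bar> powr r) =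
      (\<Sum>x\<in>{0, e, e + e}. \<bar>convolution (two_point e a) (two_point e b) x\<bar> powr r)"
    by (rule infsum_eq_sum_if_zero_outside) (auto simp: convolution_two_point[OF assms(1)])
  also have "\<dots> = 1 + (a + b) powr r + (a * b) powr r"
    using assms not_torsion
    by (simp add: convolution_two_point[OF assms(1)] eq_commute[of 0] abs_mult)
  finally show ?thesis by (simp add: lp_norm_def)
qed

lemma lp_norm_two_point:
  assumes "e \<noteq> 0" and "a \<ge> 0"
  shows "lp_norm (ereal p) (two_point e a) = (1 + a powr p) powr (1 / p)"
proof -
  have "(\<Sum>\<^sub>\<infinity>x\<in>UNIV. \<bar>two_point e a x\<bar> powr p) = (\<Sum>x\<in>{0, e}. \<bar>two_point e a x\<bar> powr p)"
    by (rule infsum_eq_sum_if_zero_outside) (auto simp: two_point_def)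
  also have "\<dots> = 1 + a powr p"
    using assms by (simp add: two_point_def eq_commute[of 0])
  finally show ?thesis by (simp add: lp_norm_def)
qed

text \<open>With \<open>1/\<infinity> = 0\<close>, the formula for the norm at \<open>a = 1\<close> includes \<open>q = \<infinity>\<close>.\<close>

lemma lp_norm_two_point_one:
  assumes "e \<noteq> 0" and "q \<ge> 1"
  shows "lp_norm q (two_point e 1) = 2 powr real_of_ereal (1 / q)"
proof (cases q)
  case (real t)
  with assms show ?thesis
    by (simp add: lp_norm_two_point one_ereal_def)
next
  case PInf
  have "(SUP x. \<bar>two_point e 1 x\<bar>) = 1"
    by (rule cSup_eq_maximum) (auto simp: two_point_def intro: rev_image_eqI[of 0])
  with PInf show ?thesis by (simp add: lp_norm_def)
qed (use assms in auto)

section \<open>Second-order condition at the maximum\<close>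

text \<open>
  The assumed inequality is the convolution inequality for \<open>b = 1\<close>, with \<open>1/q\<close> eliminated by means
  of the condition on \<open>1/p + 1/q\<close>. Both sides agree at \<open>a = 1\<close>, so the conclusion comes from a
  comparison of second derivatives there.
\<close>

lemma second_order_condition:
  fixes r p :: real
  assumes "r > 1" and "p > 0"
    and le: "\<And>a. a > 0 \<Longrightarrow> (1 + (1 + a) powr r + a powr r) powr (1 / r) \<le>
      (1 + a powr p) powr (1 / p) * 2 powr (log 2 (2 powr r + 2) / r - 1 / p)"
  shows "(r + 2 powr (r - 1)) / (1 + 2 powr (r - 1)) \<le> p"
proof (rule ccontr)
  assume contra: "\<not> ?thesis"
  define S where "S = 1 + 2 powr (r - 1)"
  have S: "S > 0" by (simp add: S_def add_pos_pos)
  have less: "p * S < r + 2 powr (r - 1)"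
    using contra S by (simp add: S_def field_simps not_le)
  define N where "N = (\<lambda>a::real. 1 + (1 + a) powr r + a powr r)"
  define h where "h = (\<lambda>a. ln (N a) / r - ln (1 + a powr p) / p)"
  define h' where "h' = (\<lambda>a. ((1 + a) powr (r - 1) + a powr (r - 1)) / N a
    - a powr (p - 1) / (1 + a powr p))"
  have N_pos: "N a > 0" for a
    by (auto simp: N_def intro!: add_pos_nonneg)
  have D_pos: "1 + a powr p > 0" for a :: real
    by (auto intro!: add_pos_nonneg)
  have two_r: "2 powr r = 2 * (2 powr (r - 1))" "2 powr (r - 1) = 2 * (2 powr (r - 2))"
    by (simp_all add: powr_diff)
  have N1: "N 1 = 2 * S"
    by (simp add: N_def S_def two_r)
  have h_le: "h a \<le> h 1" if "a > 0" for a
  proof -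
    have "ln (N a powr (1 / r)) \<le>
        ln ((1 + a powr p) powr (1 / p) * 2 powr (log 2 (2 powr r + 2) / r - 1 / p))"
      using le[OF that] N_pos[of a] D_pos[of a] by (subst ln_le_cancel_iff) (auto simp: N_def)
    hence "ln (N a) / r \<le> ln (1 + a powr p) / p + (log 2 (2 powr r + 2) / r - 1 / p) * ln 2"
      using N_pos[of a] D_pos[of a] by (simp add: ln_mult ln_powr)
    also have "(log 2 (2 powr r + 2) / r - 1 / p) * ln 2 = ln (2 powr r + 2) / r - ln 2 / p"
      by (simp add: log_def field_simps)
    finally show ?thesis by (simp add: h_def N_def add_ac)
  qed
  have deriv_pow: "((\<lambda>a. (c + a) powr t) has_real_derivative t * (c + a) powr (t - 1)) (at a)"
    if "a > 0" "c \<ge> 0" for a c t :: real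
    by (rule derivative_eq_intros refl | use that in simp)+
  have deriv_N: "(N has_real_derivative r * ((1 + a) powr (r - 1) + a powr (r - 1))) (at a)"
    if "a > 0" for a
    unfolding N_def distrib_left
    using DERIV_add[OF DERIV_add[OF DERIV_const[of 1] deriv_pow[of a 1 r]] deriv_pow[of a 0 r]] that
    by simp
  have deriv_D: "((\<lambda>a. 1 + a powr p) has_real_derivative p * a powr (p - 1)) (at a)"
    if "a > 0" for a
    using DERIV_add[OF DERIV_const[of 1] deriv_pow[of a 0 p]] that by simp
  have deriv_h: "(h has_real_derivative h' a) (at a)" if "a > 0" for a
  proof -
    have "(h has_real_derivative
        inverse (N a) * (r * ((1 + a) powr (r - 1) + a powr (r - 1))) / r
          - inverse (1 + a powr p) * (p * a powr (p - 1)) / p) (at a)"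
      unfolding h_def
      by (intro DERIV_diff DERIV_cdivide DERIV_chain2[OF DERIV_ln] deriv_N deriv_D that N_pos D_pos)
    thus ?thesis
      using assms(1,2) by (simp add: h'_def inverse_eq_divide)
  qed
  have h'1: "h' 1 = 0"
    using S by (simp add: h'_def N1 S_def add_ac)
  \<comment> \<open>\<open>K\<close> is the second derivative \<open>h''(1)\<close>; it is positive because \<open>p\<close> is too small.\<close>
  define K where "K = (r - 1) * (2 powr (r - 2) + 1) / (2 * S) - r / 4 - (p - 2) / 4"
  have "(h' has_real_derivative K) (at 1)"
  proof -
    have "((\<lambda>a. (1 + a) powr (r - 1) + a powr (r - 1)) has_real_derivative
        (r - 1) * (2 powr (r - 2) + 1)) (at 1)"
      using DERIV_add[OF deriv_pow[of 1 1 "r - 1"] deriv_pow[of 1 0 "r - 1"]]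
      by (simp add: distrib_left)
    moreover have "(N has_real_derivative r * S) (at 1)"
      using deriv_N[of 1] by (simp add: S_def add.commute)
    moreover have "((\<lambda>a. a powr (p - 1)) has_real_derivative p - 1) (at 1)"
      using deriv_pow[of 1 0 "p - 1"] by simp
    moreover have "((\<lambda>a. 1 + a powr p) has_real_derivative p) (at 1)"
      using deriv_D[of 1] by simp
    ultimately have "(h' has_real_derivative
        ((r - 1) * (2 powr (r - 2) + 1) * N 1 - ((1 + 1) powr (r - 1) + 1 powr (r - 1)) * (r * S))
          / (N 1 * N 1)
        - ((p - 1) * (1 + 1 powr p) - 1 powr (p - 1) * p) / ((1 + 1 powr p) * (1 + 1 powr p))) (at 1)"
      unfolding h'_def using N_pos[of 1] D_pos[of 1]
      by (intro DERIV_diff DERIV_divide) auto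
    also have "((r - 1) * (2 powr (r - 2) + 1) * N 1 - ((1 + 1) powr (r - 1) + 1 powr (r - 1)) * (r * S))
          / (N 1 * N 1)
        - ((p - 1) * (1 + 1 powr p) - 1 powr (p - 1) * p) / ((1 + 1 powr p) * (1 + 1 powr p))
      = ((r - 1) * (2 powr (r - 2) + 1) * (2 * S) - S * (r * S)) / (2 * S * (2 * S)) - (p - 2) / 4"
      by (simp add: N1 S_def add.commute)
    also have "\<dots> = K"
      using S by (simp add: K_def field_simps)
    finally show ?thesis .
  qed
  moreover have "K > 0"
  proof -
    have "2 * S * K = (r + 2 powr (r - 1) - p * S) / 2"
      using S by (simp add: K_def field_simps) (simp add: S_def two_r(2) algebra_simps)
    with less S show ?thesis by (smt (verit) half_gt_zero zero_less_mult_pos)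
  qed
  ultimately obtain d where d: "d > 0" "\<And>t. t > 0 \<Longrightarrow> t < d \<Longrightarrow> h' 1 < h' (1 + t)"
    using DERIV_pos_inc_right by metis
  \<comment> \<open>\<open>h'\<close> is positive just to the right of 1, so \<open>h\<close> increases there.\<close>
  have "h 1 < h (1 + d / 2)"
  proof -
    obtain z where z: "1 < z" "z < 1 + d / 2" "h (1 + d / 2) - h 1 = d / 2 * h' z"
      using MVT2[of 1 "1 + d / 2" h h'] deriv_h d(1) by auto
    have "h' z > 0" using d(2)[of "z - 1"] z h'1 by simp
    with z d(1) show ?thesis
      by (smt (verit) half_gt_zero mult_pos_pos)
  qed
  with h_le[of "1 + d / 2"] d(1) show False by simp
qed

section \<open>Bounds on the exponents\<close>

theorem proposition1p3:
  fixes r :: real and p q :: ereal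
  assumes "r > 1"
    and "1 \<le> p" and "p \<le> \<infinity>" and "1 \<le> q" and "q \<le> \<infinity>"
    and "1 / p + 1 / q = ereal (log 2 (2 powr r + 2) / r)"
    and "\<And>f g :: int ^ 'd::finite \<Rightarrow> real.
           supported_in f cube \<Longrightarrow> supported_in g cube \<Longrightarrow>
           lp_norm (ereal r) (convolution f g) \<le> lp_norm p f * lp_norm q g"
  shows "{p, q} \<subseteq>
    {ereal ((r + 2 powr (r - 1)) / (1 + 2 powr (r - 1))) ..
     ereal (1 / (log 2 (2 powr r + 2) / r - (1 + 2 powr (r - 1)) / (r + 2 powr (r - 1))))}"
proof -
  define L where "L = (r + 2 powr (r - 1)) / (1 + 2 powr (r - 1))"
  define C where "C = log 2 (2 powr r + 2) / r"
  define e :: "int ^ 'd" where "e = axis undefined 1"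
  have e: "e \<noteq> 0" by (simp add: e_def)
  have pos: "r + 2 powr (r - 1) > 0" "1 + 2 powr (r - 1) > 0"
    using assms(1) by (auto intro: add_pos_pos)
  have inv_L: "1 / L = (1 + 2 powr (r - 1)) / (r + 2 powr (r - 1))"
    by (simp add: L_def)
  have "L > 0" and inv_L_less: "1 / L < 1"
    using pos assms(1) by (simp_all add: inv_L L_def)
  moreover have "C > 1"
  proof -
    have "r < log 2 (2 powr r + 2)"
      by (subst less_log_iff) (auto intro: add_pos_pos)
    thus ?thesis using assms(1) by (simp add: C_def)
  qed
  ultimately have gap: "L > 0" "C - 1 / L > 0"
    using inv_L_less by linarith+
  have supp: "supported_in (two_point e a) cube" for a
    by (simp add: e_def supported_in_two_point_axis)
  \<comment> \<open>The hypotheses are symmetric in \<open>p\<close> and \<open>q\<close>, so \<open>(s, t)\<close> stands for \<open>(p, q)\<close> or \<open>(q, p)\<close>.\<close>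
  have lower: "ereal L \<le> s"
    if "1 \<le> s" "1 \<le> t" and sum: "1 / s + 1 / t = ereal C"
      and le: "\<And>a. a > 0 \<Longrightarrow> (1 + (1 + a) powr r + a powr r) powr (1 / r) \<le>
        lp_norm s (two_point e a) * lp_norm t (two_point e 1)" for s t
  proof (cases s)
    case (real u)
    with that have u: "u \<ge> 1" by (simp add: one_ereal_def)
    have inv_t: "real_of_ereal (1 / t) = C - 1 / u"
      using sum u \<open>1 \<le> t\<close> real by (cases t) (auto simp: one_ereal_def)
    have "L \<le> u"
      unfolding L_def
    proof (rule second_order_condition)
      fix a :: real assume "a > 0"
      with le[OF this] e u real \<open>1 \<le> t\<close> inv_t
      show "(1 + (1 + a) powr r + a powr r) powr (1 / r) \<le>
          (1 + a powr u) powr (1 / u) * 2 powr (log 2 (2 powr r + 2) / r - 1 / u)"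
        by (simp add: lp_norm_two_point lp_norm_two_point_one C_def)
    qed (use u assms(1) in auto)
    with real show ?thesis by simp
  qed (use that in auto)
  have upper: "s \<le> ereal (1 / (C - 1 / L))"
    if "1 \<le> s" "1 \<le> t" and sum: "1 / s + 1 / t = ereal C" and "ereal L \<le> t" for s t
  proof -
    have inv_t: "0 \<le> real_of_ereal (1 / t)" "real_of_ereal (1 / t) \<le> 1 / L"
      using that gap by (cases t; auto simp: one_ereal_def frac_le)+
    show ?thesis
    proof (cases s)
      case (real u)
      with that have u: "u \<ge> 1" by (simp add: one_ereal_def)
      have "real_of_ereal (1 / t) = C - 1 / u"
        using sum u \<open>1 \<le> t\<close> real by (cases t) (auto simp: one_ereal_def)
      with inv_t have "C - 1 / L \<le> 1 / u" by simp
      with u gap real show ?thesis by (simp add: field_simps)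
    next
      case PInf
      have "real_of_ereal (1 / t) = C"
        using sum PInf \<open>1 \<le> t\<close> by (cases t) (auto simp: one_ereal_def)
      with inv_t gap show ?thesis by simp
    qed (use that in auto)
  qed
  have sum: "1 / p + 1 / q = ereal C" "1 / q + 1 / p = ereal C"
    using assms(6) by (simp_all add: C_def add.commute)
  have "ereal L \<le> p"
  proof (rule lower)
    fix a :: real assume "a > 0"
    with assms(7)[OF supp supp, of a 1] lp_norm_convolution_two_point[OF e, of a 1 r]
    show "(1 + (1 + a) powr r + a powr r) powr (1 / r) \<le>
        lp_norm p (two_point e a) * lp_norm q (two_point e 1)"
      by (simp add: add_ac)
  qed (use assms sum in auto)
  moreover have "ereal L \<le> q"
  proof (rule lower)
    fix a :: real assume "a > 0"
    with assms(7)[OF supp supp, of 1 a] lp_norm_convolution_two_point[OF e, of 1 a r]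
    show "(1 + (1 + a) powr r + a powr r) powr (1 / r) \<le>
        lp_norm q (two_point e a) * lp_norm p (two_point e 1)"
      by (simp add: mult.commute)
  qed (use assms sum in auto)
  ultimately show ?thesis
    using upper[of p q] upper[of q p] assms(2,4) sum
    unfolding inv_L[symmetric] L_def[symmetric] C_def[symmetric] by simp
qed

end
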